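(* Let $G$ be a connected graph of order $n \ge 2$, and let $v\in V(G)$. Then (a) $\mathrm{cdim}_G(v)=1$ if and only if $G=P_n$ and $v$ is an end vertex of $G$; (b) $\mathrm{cdim}_G(v)=n-1$ if and only if one of the following holds: (i) $G \in \{K_2, K_3\} \cup \{K_n, K_{1,n-1}\}$, where $n \ge 4$ for the members of the second set, and $v$ is any vertex of $G$; or (ii) $G=K_{1,2}=P_3$ and $v$ is the degree-two vertex of $G$; or (iii) $G\in \mathcal{H}_1 \cup \mathcal{H}_2$ and $v=u_1$.
   Context: All graphs are finite, simple, undirected; equality of graphs means isomorphism. $P_n$, $K_n$, $K_{1,n-1}$ are the path, complete graph and star on $n$ vertices; an end vertex is a vertex of degree one. A set $S\subseteq V(G)$ is a resolving set of $G$ if for every pair of distinct vertices $x,y$ of $G$ there is $z\in S$ with $d(x,z)\ne d(y,z)$ ($d$ is the shortest-path distance); it is a connected resolving set if moreover the induced subgraph $G[S]$ is connected. $\mathrm{cdim}_G(v)$ is the minimum cardinality of a connected resolving set of $G$ containing $v$. For $2\le r\le n-2$, let $P_r$ be the path $u_1,u_2,\ldots,u_r$. $\mathcal{H}_1$ is the family of graphs of order $n$ obtained from the disjoint union of such a $P_r$ and the empty graph $\overline{K}_{n-r}$ by joining $u_r$ to every vertex of $\overline{K}_{n-r}$. $\mathcal{H}_2$ is the family of graphs of order $n$ obtained from the disjoint union of such a $P_r$ and the complete graph $K_{n-r}$ by joining $u_r$ to every vertex of $K_{n-r}$. *)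

theory Defs
  imports "Graph_Theory.Graph_Theory"
begin

text \<open>
  A finite simple undirected graph is a \<^locale>\<open>pair_graph\<close>: every undirected edge is represented
  by the two opposite arcs.
\<close>

text \<open>With unit weights, the library's weighted distance is the length of a shortest path.\<close>

definition gdist :: "'a pair_pre_digraph \<Rightarrow> 'a \<Rightarrow> 'a \<Rightarrow> ereal" where
  "gdist G x y = wf_digraph.\<mu> (with_proj G) (\<lambda>_. 1) x y"

text \<open>Since both arcs of an edge are present, the degree of a vertex is its out-degree.\<close>

abbreviation degree :: "'a pair_pre_digraph \<Rightarrow> 'a \<Rightarrow> nat" where
  "degree G v \<equiv> out_degree (with_proj G) v"

definition resolving_set :: "'a pair_pre_digraph \<Rightarrow> 'a set \<Rightarrow> bool" where
  "resolving_set G S \<longleftrightarrow> S \<subseteq> pverts G \<and>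
     (\<forall>x\<in>pverts G. \<forall>y\<in>pverts G. x \<noteq> y \<longrightarrow> (\<exists>z\<in>S. gdist G x z \<noteq> gdist G y z))"

definition connected_resolving_set :: "'a pair_pre_digraph \<Rightarrow> 'a set \<Rightarrow> bool" where
  "connected_resolving_set G S \<longleftrightarrow>
     resolving_set G S \<and> Digraph_Component.connected (with_proj G \<restriction> S)"

definition cdim :: "'a pair_pre_digraph \<Rightarrow> 'a \<Rightarrow> nat" where
  "cdim G v = Min (card ` {S. connected_resolving_set G S \<and> v \<in> S})"

text \<open>The minimum is attained whenever the graph is connected: the vertex set itself qualifies.\<close>

lemma connected_resolving_set_pverts:
  assumes "pair_graph G" and "Digraph_Component.connected (with_proj G)"
  shows "connected_resolving_set G (pverts G)"
proof -
  interpret pair_graph G by fact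
  have zero: "gdist G x x = 0" if "x \<in> pverts G" for x
  proof -
    have "gdist G x x \<le> 0"
      unfolding gdist_def
      using min_cost_le_walk_cost[of x "[]" x "\<lambda>_. 1"] that
      by (simp add: awalk_Nil_iff zero_ereal_def)
    moreover have "0 \<le> gdist G x x"
      unfolding gdist_def \<mu>_def
      by (rule INF_greatest) (auto intro: pos_cost_pos_awalk_cost)
    ultimately show ?thesis by simp
  qed
  have pos: "gdist G x y \<noteq> 0" if "x \<noteq> y" for x y
  proof -
    have "1 \<le> awalk_cost (\<lambda>_. 1) p" if "awalk x p y" for p
    proof (cases p)
      case Nil
      with \<open>x \<noteq> y\<close> that show ?thesis by (simp add: awalk_Nil_iff)
    next
      case (Cons e es)
      then show ?thesis
        by (simp add: awalk_cost_def sum_list_triv)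
    qed
    then have "1 \<le> gdist G x y"
      unfolding gdist_def \<mu>_def by (auto intro!: INF_greatest)
    then show ?thesis by auto
  qed
  have "with_proj G \<restriction> pverts G = with_proj G"
    using wellformed' by (auto simp: induce_subgraph_def with_proj_def)
  moreover have "resolving_set G (pverts G)"
    unfolding resolving_set_def using zero pos by (metis subset_refl)
  ultimately show ?thesis
    using assms(2) by (simp add: connected_resolving_set_def)
qed

text \<open>\<open>P\<^sub>n\<close>, with vertices \<open>u\<^sub>i = i\<close> for \<open>1 \<le> i \<le> n\<close>.\<close>

definition path_graph :: "nat \<Rightarrow> nat pair_pre_digraph" where
  "path_graph n = \<lparr> pverts = {1..n},
     parcs = {(i, j). i \<in> {1..n} \<and> j \<in> {1..n} \<and> (j = i + 1 \<or> i = j + 1)} \<rparr>"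

definition empty_graph_on :: "'a set \<Rightarrow> 'a pair_pre_digraph" where
  "empty_graph_on A = \<lparr> pverts = A, parcs = {} \<rparr>"

definition complete_graph_on :: "'a set \<Rightarrow> 'a pair_pre_digraph" where
  "complete_graph_on A = \<lparr> pverts = A, parcs = {(x, y). x \<in> A \<and> y \<in> A \<and> x \<noteq> y} \<rparr>"

text \<open>
  The union of \<open>P\<^sub>r\<close> and \<open>H\<close> with \<open>u\<^sub>r = r\<close> joined to every vertex of \<open>H\<close>; it is used only for \<open>H\<close>
  with vertex set \<open>{r+1..n}\<close>, which is disjoint from that of \<open>P\<^sub>r\<close>.
\<close>

definition attach_to_path :: "nat \<Rightarrow> nat pair_pre_digraph \<Rightarrow> nat pair_pre_digraph" where
  "attach_to_path r H = \<lparr> pverts = pverts (path_graph r) \<union> pverts H,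
     parcs = parcs (path_graph r) \<union> parcs H \<union> {r} \<times> pverts H \<union> pverts H \<times> {r} \<rparr>"

text \<open>
  The members of order \<open>n\<close> of the two families, up to isomorphism; in each of them \<open>u\<^sub>1\<close> is the
  vertex \<open>1\<close>. The bound \<open>r + 2 \<le> n\<close> is \<open>r \<le> n - 2\<close> without truncated subtraction.
\<close>

definition H1_family :: "nat \<Rightarrow> nat pair_pre_digraph set" where
  "H1_family n = {attach_to_path r (empty_graph_on {r+1..n}) | r. 2 \<le> r \<and> r + 2 \<le> n}"

definition H2_family :: "nat \<Rightarrow> nat pair_pre_digraph set" where
  "H2_family n = {attach_to_path r (complete_graph_on {r+1..n}) | r. 2 \<le> r \<and> r + 2 \<le> n}"

text \<open>\<open>H\<close> and \<open>G\<close> are isomorphic by an isomorphism that takes the vertex \<open>u\<close> of \<open>H\<close> to \<open>v\<close>.\<close>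

definition iso_mapping ::
  "'a pair_pre_digraph \<Rightarrow> 'a \<Rightarrow> 'b pair_pre_digraph \<Rightarrow> 'b \<Rightarrow> bool" where
  "iso_mapping H u G v \<longleftrightarrow>
     (\<exists>f. pre_digraph.digraph_isomorphism (with_proj H) f \<and>
          with_proj G = app_iso f (with_proj H) \<and> iso_verts f u = v)"

end

theory Submission
  imports Defs
begin

text \<open>
  Sort the vertices into layers by their distance from \<open>v\<close>. For the first part, a single vertex
  \<open>v\<close> resolves the graph exactly when each layer has one vertex, and then consecutive layers form a
  path that starts at \<open>v\<close>.

  For the second part, call two vertices twins if they have the same neighbours outside the pair.
  Twins have the same distance to every third vertex, so a resolving set misses at most one vertex
  of a set of pairwise twins. Conversely, \<open>V - {x, y}\<close> is resolving unless \<open>x\<close> and \<open>y\<close> are twins.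
  So if the connected dimension at \<open>v\<close> is as large as \<open>n - 1\<close>, then any \<open>x, y \<noteq> v\<close> whose removal
  leaves a connected graph are twins; and two twins other than \<open>v\<close> lie in the same layer. Let \<open>e\<close>
  be the greatest distance from \<open>v\<close>.

    \<^item> Two vertices of layer \<open>e\<close> can be removed, so this layer consists of pairwise twins.
    \<^item> If an earlier layer \<open>i\<close> had two vertices, then one of them could be removed together with a
      vertex of layer \<open>e\<close>, although these lie in different layers. Going downwards from layer
      \<open>e\<close>, the vertices of layer \<open>i + 1\<close> all have the same neighbours in layer \<open>i\<close>, so it suffices
      to keep one of these neighbours and remove another vertex of layer \<open>i\<close>.
    \<^item> If \<open>e \<ge> 2\<close> and layer \<open>e\<close> had just one vertex, that vertex could be removed together with the
      vertex of layer \<open>e - 1\<close>.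

  Such a graph is called a broom here: a path from \<open>v\<close> whose last vertex is joined to a set of
  twins, which is either independent or a clique (lemmas \<open>broom_if_cdim_large\<close> and
  \<open>broom_adjacency\<close>). In the other direction, a connected resolving set of a broom must contain the
  whole path in order to link \<open>v\<close> with the twins, and all twins but at most one (lemma \<open>cdim_broom\<close>).
  Up to isomorphism there are at most two brooms for each order \<open>n\<close> and each \<open>e\<close>, one for each kind of twin
  set (lemma \<open>broom_iff_iso_mapping\<close>). Those with \<open>2 \<le> e \<le> n - 2\<close> are the members of the two
  families with \<open>r = e\<close>; those with \<open>e = 1\<close> are the complete graph and the star with centre \<open>v\<close>;
  and for \<open>e = n - 1\<close> both are the path with \<open>v\<close> at its end, which also settles the first part.
  A star with \<open>v\<close> at a leaf is a broom with \<open>e = 2\<close>.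
\<close>

section \<open>Hop distance\<close>

locale connected_graph = pair_graph G for G :: "'a pair_pre_digraph" +
  assumes conn: "Digraph_Component.connected (with_proj G)"
begin

abbreviation "V \<equiv> pverts G"
abbreviation "E \<equiv> parcs G"

text \<open>
  A natural number in place of the extended real \<open>gdist\<close>; in a connected graph some power of the
  arc relation contains the pair, so the minimum is attained.
\<close>

definition hops :: "'a \<Rightarrow> 'a \<Rightarrow> nat" where
  "hops x y = (LEAST k. (x, y) \<in> E ^^ k)"

lemma arc_sym: "(x, y) \<in> E \<Longrightarrow> (y, x) \<in> E"
  using pair_sym_arcs arcs_ends_symmetric[of "with_proj G"] by auto

lemma arc_verts: "(x, y) \<in> E \<Longrightarrow> x \<in> V \<and> y \<in> V"
  by (auto dest: wellformed')

lemma arc_irrefl: "(x, x) \<notin> E"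
  using pair_no_loops by force

lemma relpow_sym: "(x, y) \<in> E ^^ k \<Longrightarrow> (y, x) \<in> E ^^ k"
proof (induction k arbitrary: y)
  case (Suc k)
  then obtain w where "(x, w) \<in> E ^^ k" "(w, y) \<in> E" by auto
  then show ?case using Suc.IH arc_sym relpow_Suc_I2 by metis
qed simp

lemma awalk_imp_relpow: "awalk x p y \<Longrightarrow> (x, y) \<in> E ^^ length p"
proof (induction p arbitrary: x)
  case Nil
  then show ?case by (simp add: awalk_Nil_iff)
next
  case (Cons e p)
  then have "(snd e, y) \<in> E ^^ length p" "e \<in> E" "fst e = x"
    by (auto simp: awalk_Cons_iff)
  then show ?case
    using relpow_Suc_I2[of x "snd e" E y] by (cases e) auto
qed

lemma relpow_imp_awalk: "x \<in> V \<Longrightarrow> (x, y) \<in> E ^^ k \<Longrightarrow> \<exists>p. awalk x p y \<and> length p = k"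
proof (induction k arbitrary: x)
  case 0
  then show ?case by (auto simp: awalk_Nil_iff)
next
  case (Suc k)
  then obtain w where w: "(x, w) \<in> E" "(w, y) \<in> E ^^ k"
    by (meson relpow_Suc_E2)
  with Suc.IH arc_verts obtain p where "awalk w p y" "length p = k" by blast
  with w Suc.prems show ?case
    by (intro exI[of _ "(x, w) # p"]) (auto simp: awalk_Cons_iff)
qed

text \<open>
  The library's notion of connectedness passes to the symmetric closure of the induced subgraph;
  since the arcs are symmetric already, this is reachability inside \<open>S\<close>.
\<close>

lemma connected_induce_iff:
  "Digraph_Component.connected (with_proj G \<restriction> S) \<longleftrightarrow>
     S \<noteq> {} \<and> (\<forall>x\<in>S. \<forall>y\<in>S. (x, y) \<in> rtrancl_on S E)"
proof -
  have arcs: "parcs (mk_symmetric (with_proj G \<restriction> S)) = E \<inter> S \<times> S"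
    using arc_sym by (auto simp: parcs_mk_symmetric)
  have "rtrancl_on S (E \<inter> S \<times> S) = rtrancl_on S E"
  proof (intro equalityI subrelI)
    fix x y assume "(x, y) \<in> rtrancl_on S E"
    then show "(x, y) \<in> rtrancl_on S (E \<inter> S \<times> S)"
      by induct (auto intro: converse_rtrancl_on_into_rtrancl_on)
  qed (auto intro: rtrancl_on_mono[rotated -1])
  with arcs show ?thesis
    by (simp add: connected_def strongly_connected_def reachable_def)
qed

lemma induce_verts: "with_proj G \<restriction> V = with_proj G"
  using wellformed' by (auto simp: induce_subgraph_def with_proj_def)

lemma hops_relpow:
  assumes "x \<in> V" "y \<in> V"
  shows "(x, y) \<in> E ^^ hops x y"
proof -
  have "(x, y) \<in> rtrancl_on V E"
    using conn connected_induce_iff[of V] assms by (simp add: induce_verts)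
  then have "(x, y) \<in> E\<^sup>*" by (rule rtrancl_on_rtranclI)
  then obtain k where "(x, y) \<in> E ^^ k" by (auto simp: rtrancl_is_UN_relpow)
  then show ?thesis unfolding hops_def by (rule LeastI)
qed

lemma hops_le: "(x, y) \<in> E ^^ k \<Longrightarrow> hops x y \<le> k"
  unfolding hops_def by (rule Least_le)

lemma gdist_eq_hops:
  assumes "x \<in> V" "y \<in> V"
  shows "gdist G x y = ereal (hops x y)"
proof -
  have cost: "awalk_cost (\<lambda>_. 1) p = real (length p)" for p :: "('a \<times> 'a) list"
    by (simp add: awalk_cost_def sum_list_triv)
  obtain p where p: "awalk x p y" "length p = hops x y"
    using relpow_imp_awalk[OF assms(1) hops_relpow[OF assms]] by auto
  show ?thesis
  proof (rule antisym)
    show "gdist G x y \<le> ereal (hops x y)"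
      using min_cost_le_walk_cost[OF p(1), of "\<lambda>_. 1"] p(2) by (simp add: gdist_def cost)
    show "ereal (hops x y) \<le> gdist G x y"
      unfolding gdist_def \<mu>_def
      by (rule INF_greatest) (auto simp: cost dest!: awalk_imp_relpow hops_le)
  qed
qed

lemma hops_self [simp]: "hops x x = 0"
  using hops_le[of x x 0] by simp

lemma hops_eq_0_iff: "x \<in> V \<Longrightarrow> y \<in> V \<Longrightarrow> hops x y = 0 \<longleftrightarrow> x = y"
  using hops_relpow[of x y] by auto

lemma hops_commute: "hops x y = hops y x"
  unfolding hops_def using relpow_sym by (metis (no_types, lifting))

lemma hops_step: "v \<in> V \<Longrightarrow> (x, y) \<in> E \<Longrightarrow> hops v y \<le> Suc (hops v x)"
  using hops_relpow[of v x] arc_verts by (intro hops_le) auto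

lemma hops_parent:
  assumes "v \<in> V" "x \<in> V" "x \<noteq> v"
  obtains y where "(y, x) \<in> E" "hops v x = Suc (hops v y)"
proof -
  obtain k where k: "hops v x = Suc k"
    using hops_eq_0_iff assms by (cases "hops v x") auto
  then have "(v, x) \<in> E ^^ Suc k" using hops_relpow assms by metis
  then obtain y where y: "(v, y) \<in> E ^^ k" "(y, x) \<in> E" by auto
  moreover have "hops v y = k"
    using hops_le[OF y(1)] hops_step[OF assms(1) y(2)] k by simp
  ultimately show ?thesis using that k by simp
qed

text \<open>
  A certificate for the distance from \<open>v\<close>: no arc can raise \<open>h\<close> by more than one, so \<open>h\<close> is a
  lower bound, and descending along the neighbours with smaller \<open>h\<close> gives a walk of that length.
\<close>

lemma hops_eqI:
  assumes v: "v \<in> V" and h0: "h v = 0"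
    and step: "\<And>x y. (x, y) \<in> E \<Longrightarrow> h y \<le> Suc (h x)"
    and parent: "\<And>x. x \<in> V \<Longrightarrow> x \<noteq> v \<Longrightarrow> \<exists>y. (y, x) \<in> E \<and> h y < h x"
    and x: "x \<in> V"
  shows "hops v x = h x"
proof (rule antisym)
  show "hops v x \<le> h x"
    using x
  proof (induction "h x" arbitrary: x rule: less_induct)
    case less
    show ?case
    proof (cases "x = v")
      case False
      then obtain y where "(y, x) \<in> E" "h y < h x" using parent less.prems by auto
      then show ?thesis
        using less.hyps[of y] hops_step[OF v, of y x] arc_verts[of y x] by auto
    qed simp
  qed
  have "(v, x) \<in> E ^^ k \<Longrightarrow> h x \<le> k" for k x
  proof (induction k arbitrary: x)
    case (Suc k)
    then obtain y where "(v, y) \<in> E ^^ k" "(y, x) \<in> E" by auto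
    then show ?case using Suc.IH[of y] step[of y x] by simp
  qed (use h0 in simp)
  then show "h x \<le> hops v x" using hops_relpow v x by blast
qed

lemma hops_eq_1_iff: "x \<in> V \<Longrightarrow> y \<in> V \<Longrightarrow> hops x y = 1 \<longleftrightarrow> (x, y) \<in> E"
  using hops_relpow[of x y] hops_le[of x y 1] hops_eq_0_iff[of x y] arc_irrefl
  by (cases "hops x y") (auto simp: le_Suc_eq)

section \<open>Connected sets and layers\<close>

text \<open>
  Below, connectedness is established only in this way: in place of paths, it is enough
  that every vertex keeps one neighbour closer to \<open>v\<close>.
\<close>

lemma connected_induceI:
  assumes v: "v \<in> S"
    and parent: "\<And>x. x \<in> S \<Longrightarrow> x \<noteq> v \<Longrightarrow> \<exists>y\<in>S. (y, x) \<in> E \<and> hops v y < hops v x"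
  shows "Digraph_Component.connected (with_proj G \<restriction> S)"
proof -
  have reach: "(v, x) \<in> rtrancl_on S E" if "x \<in> S" for x
    using that
  proof (induction "hops v x" arbitrary: x rule: less_induct)
    case less
    show ?case
    proof (cases "x = v")
      case False
      then obtain y where "y \<in> S" "(y, x) \<in> E" "hops v y < hops v x"
        using parent less.prems by blast
      then show ?thesis using less by (blast intro: rtrancl_on_into_rtrancl_on)
    qed (use v in simp)
  qed
  have "sym (rtrancl_on S E)" by (rule rtrancl_on_sym) (auto intro: symI arc_sym)
  then have "(x, y) \<in> rtrancl_on S E" if "x \<in> S" "y \<in> S" for x y
    using reach that by (meson rtrancl_on_trans symD)
  then show ?thesis using v by (auto simp: connected_induce_iff)
qed

text \<open>
  A discrete intermediate value theorem: the distance from \<open>v\<close> increases by at most one at each step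
  of a walk from \<open>v\<close> to \<open>t\<close> inside \<open>S\<close>.
\<close>

lemma connected_meets_layers:
  assumes S: "Digraph_Component.connected (with_proj G \<restriction> S)" "S \<subseteq> V"
    and "v \<in> S" "t \<in> S" "i \<le> hops v t"
  obtains x where "x \<in> S" "hops v x = i"
proof -
  have "(v, t) \<in> rtrancl_on S E" using assms connected_induce_iff by blast
  then have "\<forall>i\<le>hops v t. \<exists>x\<in>S. hops v x = i"
  proof (induct rule: rtrancl_on_induct)
    case base
    show ?case using assms(3) by (auto intro!: bexI[of _ v])
  next
    case (step y z)
    have "v \<in> V" using assms by blast
    then have "hops v z \<le> Suc (hops v y)" using hops_step step(2) by blast
    then have "i \<le> hops v y \<or> i = hops v z" if "i \<le> hops v z" for i using that by linarith
    then show ?case using step(4,5) by blast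
  qed
  then show ?thesis using assms that by blast
qed

lemma layer_nonempty:
  assumes "v \<in> V" "t \<in> V" "i \<le> hops v t"
  obtains x where "x \<in> V" "hops v x = i"
  using connected_meets_layers[of V v t i] conn assms by (auto simp: induce_verts)

lemma eccentricity:
  assumes v: "v \<in> V" and n: "2 \<le> card V"
  obtains e t where "1 \<le> e" "\<And>x. x \<in> V \<Longrightarrow> hops v x \<le> e" "t \<in> V" "hops v t = e"
proof -
  have fin: "finite (hops v ` V)" using pair_finite_verts by simp
  have le: "hops v x \<le> Max (hops v ` V)" if "x \<in> V" for x
    using Max_ge[OF fin] that by simp
  have "hops v ` V \<noteq> {}" using v by blast
  from Max_in[OF fin this] obtain t where t: "t \<in> V" "hops v t = Max (hops v ` V)"
    by (metis imageE)
  have "V \<noteq> {v}" using n by auto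
  then obtain u where u: "u \<in> V" "u \<noteq> v" using v by blast
  then have "hops v u \<noteq> 0" using hops_eq_0_iff v by blast
  then have "1 \<le> Max (hops v ` V)" using le[OF u(1)] by simp
  with le t that show ?thesis by blast
qed

section \<open>Twins and resolving sets\<close>

definition twins :: "'a \<Rightarrow> 'a \<Rightarrow> bool" where
  "twins x y \<longleftrightarrow> (\<forall>z\<in>V - {x, y}. (x, z) \<in> E \<longleftrightarrow> (y, z) \<in> E)"

lemma twins_refl: "twins x x"
  by (simp add: twins_def)

lemma twins_commute: "twins x y \<longleftrightarrow> twins y x"
  by (auto simp: twins_def)

text \<open>
  A shortest path from \<open>z\<close> to \<open>y\<close> passes through \<open>x\<close> just before its end, or its last step can be
  replaced by a step to \<open>x\<close>.
\<close>

lemma twins_hops_le: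
  assumes tw: "twins x y" and V: "x \<in> V" "y \<in> V" "z \<in> V" "z \<noteq> x" "z \<noteq> y"
  shows "hops z x \<le> hops z y"
proof -
  obtain w where w: "(w, y) \<in> E" "hops z y = Suc (hops z w)"
    using hops_parent[of z y] V by metis
  show ?thesis
  proof (cases "w = x")
    case False
    have "w \<noteq> y" using w arc_irrefl by auto
    then have "(w, x) \<in> E" using w tw False arc_sym arc_verts unfolding twins_def by blast
    then show ?thesis using hops_step w V by fastforce
  qed (use w in simp)
qed

lemma twins_hops_eq:
  assumes "twins x y" "x \<in> V" "y \<in> V" "z \<in> V" "z \<noteq> x" "z \<noteq> y"
  shows "hops z x = hops z y"
  using assms twins_hops_le[of x y z] twins_hops_le[of y x z] twins_commute[of x y] by simp

lemma twins_iff_hops: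
  assumes "x \<in> V" "y \<in> V"
  shows "twins x y \<longleftrightarrow> (\<forall>z\<in>V - {x, y}. hops z x = hops z y)"
proof
  assume "twins x y"
  then show "\<forall>z\<in>V - {x, y}. hops z x = hops z y"
    using twins_hops_eq assms by blast
next
  assume "\<forall>z\<in>V - {x, y}. hops z x = hops z y"
  then show "twins x y"
    unfolding twins_def using assms hops_eq_1_iff arc_sym by (metis DiffE)
qed

text \<open>
  An arc inside \<open>T\<close> can be moved to any other pair in \<open>T\<close> by exchanging one end for a twin at a time.
\<close>

lemma twins_homogeneous:
  assumes tw: "\<And>x y. x \<in> T \<Longrightarrow> y \<in> T \<Longrightarrow> twins x y" and T: "T \<subseteq> V"
  obtains q where "\<And>x y. x \<in> T \<Longrightarrow> y \<in> T \<Longrightarrow> x \<noteq> y \<Longrightarrow> (x, y) \<in> E \<longleftrightarrow> q"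
proof -
  have move: "(p, z) \<in> E" if "(x, z) \<in> E" "x \<in> T" "p \<in> T" "z \<in> T" "z \<noteq> p" for x p z
    using that tw[of x p] T arc_irrefl unfolding twins_def by blast
  have "(p, q) \<in> E" if "(x, y) \<in> E" "x \<in> T" "y \<in> T" "p \<in> T" "q \<in> T" "p \<noteq> q" for x y p q
    using that by (metis move arc_sym)
  then have "(p, q) \<in> E \<longleftrightarrow> (\<exists>x\<in>T. \<exists>y\<in>T. (x, y) \<in> E)" if "p \<in> T" "q \<in> T" "p \<noteq> q" for p q
    using that by blast
  then show ?thesis using that by blast
qed

lemma resolving_set_iff_hops:
  "resolving_set G S \<longleftrightarrow> S \<subseteq> V \<and> (\<forall>x\<in>V. \<forall>y\<in>V. x \<noteq> y \<longrightarrow> (\<exists>z\<in>S. hops z x \<noteq> hops z y))"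
proof -
  have "gdist G x z = gdist G y z \<longleftrightarrow> hops z x = hops z y" if "x \<in> V" "y \<in> V" "z \<in> V" for x y z
    using that by (simp add: gdist_eq_hops hops_commute[of _ z])
  then show ?thesis unfolding resolving_set_def by (meson subsetD)
qed

lemma resolving_set_singleton_iff:
  "v \<in> V \<Longrightarrow> resolving_set G {v} \<longleftrightarrow> inj_on (hops v) V"
  by (auto simp: resolving_set_iff_hops inj_on_def)

text \<open>
  A pair with an element in the set is resolved by that element, so only the pair \<open>x, y\<close> matters.
\<close>

lemma resolving_set_Diff_pair:
  assumes "x \<in> V" "y \<in> V" "\<not> twins x y"
  shows "resolving_set G (V - {x, y})"
  unfolding resolving_set_iff_hops
proof (intro conjI ballI impI)
  fix a b assume ab: "a \<in> V" "b \<in> V" "a \<noteq> b"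
  show "\<exists>z\<in>V - {x, y}. hops z a \<noteq> hops z b"
  proof (cases "{a, b} \<subseteq> {x, y}")
    case True
    moreover have "\<exists>z\<in>V - {x, y}. hops z x \<noteq> hops z y"
      using assms twins_iff_hops by blast
    ultimately show ?thesis using ab(3) by (metis insert_subset insertE singletonD)
  next
    case False
    then show ?thesis using ab hops_eq_0_iff by (metis DiffI hops_self insert_subset empty_subsetI)
  qed
qed auto

lemma resolving_set_meets_twins:
  assumes "resolving_set G S" "twins x y" "x \<in> V" "y \<in> V" "x \<noteq> y"
  shows "x \<in> S \<or> y \<in> S"
proof -
  obtain z where "z \<in> S" "z \<in> V" "hops z x \<noteq> hops z y"
    using assms unfolding resolving_set_iff_hops by blast
  then show ?thesis using assms twins_iff_hops[of x y] by blast
qed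

lemma finite_card_candidates:
  "finite (card ` {S. connected_resolving_set G S \<and> v \<in> S})"
proof -
  have "{S. connected_resolving_set G S \<and> v \<in> S} \<subseteq> Pow V"
    by (auto simp: connected_resolving_set_def resolving_set_def)
  then show ?thesis using pair_finite_verts finite_subset by blast
qed

lemma cdim_le:
  "connected_resolving_set G S \<Longrightarrow> v \<in> S \<Longrightarrow> cdim G v \<le> card S"
  unfolding cdim_def by (rule Min_le[OF finite_card_candidates]) blast

lemma cdim_attained:
  assumes "v \<in> V"
  obtains S where "connected_resolving_set G S" "v \<in> S" "card S = cdim G v"
proof -
  have "V \<in> {S. connected_resolving_set G S \<and> v \<in> S}"
    using assms connected_resolving_set_pverts[OF _ conn] pair_graph_axioms by simp
  then have "card ` {S. connected_resolving_set G S \<and> v \<in> S} \<noteq> {}" by blast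
  from Min_in[OF finite_card_candidates this] show ?thesis
    using that unfolding cdim_def by auto
qed

text \<open>
  A connected resolving set of size one that contains \<open>v\<close> can only be \<open>{v}\<close>.
\<close>

lemma cdim_eq_1_iff_inj:
  assumes v: "v \<in> V"
  shows "cdim G v = 1 \<longleftrightarrow> inj_on (hops v) V"
proof
  assume "cdim G v = 1"
  then obtain S where "connected_resolving_set G S" "v \<in> S" "card S = 1"
    using cdim_attained[OF v] by metis
  then show "inj_on (hops v) V"
    using resolving_set_singleton_iff[OF v]
    by (metis card_1_singletonE connected_resolving_set_def singletonD)
next
  assume "inj_on (hops v) V"
  moreover have "Digraph_Component.connected (with_proj G \<restriction> {v})"
    by (rule connected_induceI[of v]) auto
  ultimately have "connected_resolving_set G {v}"
    using resolving_set_singleton_iff[OF v] by (simp add: connected_resolving_set_def)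
  then have le: "cdim G v \<le> 1" using cdim_le[of "{v}"] by simp
  obtain S where S: "connected_resolving_set G S" "v \<in> S" "card S = cdim G v"
    using cdim_attained[OF v] by blast
  have "finite S"
    using S(1) pair_finite_verts finite_subset
    unfolding connected_resolving_set_def resolving_set_def by blast
  then have "1 \<le> card S" using S(2) by (auto simp: Suc_le_eq card_gt_0_iff)
  with le show "cdim G v = 1" using S(3) by simp
qed

section \<open>Brooms\<close>

text \<open>
  A path from \<open>v\<close> (the layers below \<open>e\<close>) followed by one layer of pairwise twins. Layers of size one
  are expressed by injectivity of the distance; they are nonempty because layer \<open>e\<close> is.
\<close>

definition broom :: "'a \<Rightarrow> nat \<Rightarrow> bool" where
  "broom v e \<longleftrightarrow> 1 \<le> e \<and> (\<forall>x\<in>V. hops v x \<le> e) \<and>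
     inj_on (hops v) {x\<in>V. hops v x < e} \<and>
     (\<forall>x\<in>V. \<forall>y\<in>V. hops v x = e \<longrightarrow> hops v y = e \<longrightarrow> twins x y) \<and>
     {x\<in>V. hops v x = e} \<noteq> {}"

lemma broom_le: "broom v e \<Longrightarrow> x \<in> V \<Longrightarrow> hops v x \<le> e"
  by (simp add: broom_def)

lemma broom_inj:
  assumes "broom v e" "x \<in> V" "y \<in> V" "hops v x = hops v y" "hops v x \<noteq> e"
  shows "x = y"
proof -
  have "hops v x < e" using assms unfolding broom_def by (meson le_neq_implies_less)
  then have "x \<in> {x\<in>V. hops v x < e}" "y \<in> {x\<in>V. hops v x < e}" using assms by auto
  then show ?thesis using assms(1,4) unfolding broom_def by (meson inj_onD)
qed

text \<open>
  If two vertices are missing from \<open>S\<close>, they are not both in the last layer, as they would be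
  unresolved twins. So one lies on the path. But \<open>S\<close> also contains a vertex of the last layer, so it
  must meet every layer and hence contain the path. The side condition excludes paths of length at
  least two, where \<open>{v}\<close> itself is resolving.
\<close>

lemma cdim_broom_ge:
  assumes v: "v \<in> V" and b: "broom v e" and wide: "e = 1 \<or> 2 \<le> card {x\<in>V. hops v x = e}"
    and S: "connected_resolving_set G S" "v \<in> S"
  shows "card V - 1 \<le> card S"
proof (rule ccontr)
  assume less: "\<not> card V - 1 \<le> card S"
  have res: "resolving_set G S" and con: "Digraph_Component.connected (with_proj G \<restriction> S)"
    and SV: "S \<subseteq> V"
    using S by (auto simp: connected_resolving_set_def resolving_set_def)
  have twin_S: "x \<in> S \<or> y \<in> S" if "x \<in> V" "y \<in> V" "hops v x = e" "hops v y = e" "x \<noteq> y" for x y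
    using resolving_set_meets_twins[OF res] b that unfolding broom_def by blast
  have "2 \<le> card (V - S)"
    using less SV card_Diff_subset[of S V] finite_subset[OF SV pair_finite_verts] by linarith
  then obtain x y where xy: "x \<in> V - S" "y \<in> V - S" "x \<noteq> y"
    using pair_finite_verts card_le_Suc0_iff_eq[of "V - S"] by fastforce
  then obtain z where z: "z \<in> V" "z \<notin> S" "hops v z < e"
    using twin_S[of x y] b unfolding broom_def by (metis DiffE le_neq_implies_less)
  have "e \<noteq> 1" using z S(2) v hops_eq_0_iff[of v z] by auto
  with wide have "2 \<le> card {x\<in>V. hops v x = e}" by simp
  then obtain t where t: "t \<in> S" "hops v t = e"
    using twin_S pair_finite_verts card_le_Suc0_iff_eq[of "{x\<in>V. hops v x = e}"] by fastforce
  then obtain s where s: "s \<in> S" "hops v s = hops v z"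
    using connected_meets_layers[OF con SV S(2), of t "hops v z"] z by auto
  then have "s = z" using b z SV unfolding broom_def inj_on_def by auto
  with s z show False by simp
qed

text \<open>
  The lower bound is attained by leaving out one vertex of the last layer: no other vertex needs it
  to get closer to \<open>v\<close>.
\<close>

lemma cdim_broom:
  assumes v: "v \<in> V" and b: "broom v e" and wide: "e = 1 \<or> 2 \<le> card {x\<in>V. hops v x = e}"
  shows "cdim G v = card V - 1"
proof (rule antisym)
  show "card V - 1 \<le> cdim G v"
    using cdim_attained[OF v] cdim_broom_ge[OF v b wide] by metis
  obtain t where t: "t \<in> V" "hops v t = e" using b by (auto simp: broom_def)
  have "1 \<le> e" and le: "\<And>x. x \<in> V \<Longrightarrow> hops v x \<le> e" using b by (auto simp: broom_def)
  then have "t \<noteq> v" using t by auto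
  have "resolving_set G (V - {t})"
    unfolding resolving_set_iff_hops using hops_eq_0_iff
    by (metis Diff_iff Diff_subset hops_self singletonD)
  moreover have "Digraph_Component.connected (with_proj G \<restriction> (V - {t}))"
  proof (rule connected_induceI)
    fix x assume x: "x \<in> V - {t}" "x \<noteq> v"
    then obtain y where "(y, x) \<in> E" "hops v x = Suc (hops v y)" using hops_parent v by blast
    then show "\<exists>y\<in>V - {t}. (y, x) \<in> E \<and> hops v y < hops v x"
      using le[of x] x t arc_verts by (intro bexI[of _ y]) auto
  qed (use v \<open>t \<noteq> v\<close> in simp)
  ultimately have "cdim G v \<le> card (V - {t})"
    using v \<open>t \<noteq> v\<close> by (intro cdim_le) (auto simp: connected_resolving_set_def)
  then show "cdim G v \<le> card V - 1" using t pair_finite_verts by simp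
qed

text \<open>
  The converse side of the argument: were \<open>x, y\<close> not twins, \<open>V - {x, y}\<close> would be a connected
  resolving set with \<open>n - 2\<close> elements. The last hypothesis ensures that it is connected.
\<close>

lemma twins_if_cdim_large:
  assumes v: "v \<in> V" and large: "card V - 1 \<le> cdim G v"
    and xy: "x \<in> V" "y \<in> V" "x \<noteq> y" "x \<noteq> v" "y \<noteq> v"
    and parent: "\<And>z. z \<in> V - {x, y, v} \<Longrightarrow> \<exists>w. w \<notin> {x, y} \<and> (w, z) \<in> E \<and> hops v w < hops v z"
  shows "twins x y"
proof (rule ccontr)
  assume "\<not> twins x y"
  then have "resolving_set G (V - {x, y})" using resolving_set_Diff_pair xy by blast
  moreover have "Digraph_Component.connected (with_proj G \<restriction> (V - {x, y}))"
  proof (rule connected_induceI)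
    fix z assume "z \<in> V - {x, y}" "z \<noteq> v"
    then show "\<exists>w\<in>V - {x, y}. (w, z) \<in> E \<and> hops v w < hops v z"
      using parent[of z] arc_verts by blast
  qed (use v xy in simp)
  ultimately have "cdim G v \<le> card (V - {x, y})"
    using v xy by (intro cdim_le) (auto simp: connected_resolving_set_def)
  moreover have "card (V - {x, y}) = card V - 2"
    using xy pair_finite_verts by (simp add: card_Diff_subset)
  moreover have "3 \<le> card V"
    using card_mono[OF pair_finite_verts, of "{x, y, v}"] xy v by simp
  ultimately show False using large by simp
qed

text \<open>
  In every step a removable pair is exhibited; its members must be twins, which is impossible when
  they lie in different layers.
\<close>

lemma broom_if_cdim_large:
  assumes v: "v \<in> V" and n: "2 \<le> card V" and large: "card V - 1 \<le> cdim G v"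
  shows "\<exists>e. broom v e \<and> (e = 1 \<or> 2 \<le> card {x\<in>V. hops v x = e})"
proof -
  obtain e t where e1: "1 \<le> e" and le: "\<And>x. x \<in> V \<Longrightarrow> hops v x \<le> e"
    and t: "t \<in> V" "hops v t = e"
    using eccentricity[OF v n] by metis
  have parentE: "\<exists>y. (y, x) \<in> E \<and> hops v x = Suc (hops v y) \<and> y \<in> V \<and> hops v y < e"
    if "x \<in> V" "x \<noteq> v" for x
  proof -
    obtain y where "(y, x) \<in> E" "hops v x = Suc (hops v y)" using hops_parent[OF v \<open>x \<in> V\<close> \<open>x \<noteq> v\<close>] .
    then show ?thesis using le[OF that(1)] arc_verts by auto
  qed
  have last_twins: "twins x y" if "x \<in> V" "y \<in> V" "hops v x = e" "hops v y = e" for x y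
  proof (cases "x = y")
    case True
    then show ?thesis by (simp add: twins_refl)
  next
    case False
    show ?thesis
    proof (rule twins_if_cdim_large[OF v large])
      fix z assume "z \<in> V - {x, y, v}"
      then show "\<exists>w. w \<notin> {x, y} \<and> (w, z) \<in> E \<and> hops v w < hops v z"
        using parentE[of z] that by fastforce
    qed (use that False e1 in auto)
  qed
  \<comment> \<open>If layer \<open>i + 1\<close> has uniform neighbourhoods in layer \<open>i\<close>, keep one such neighbour \<open>p\<close> and remove
    some other vertex \<open>a\<close> of layer \<open>i\<close> together with the farthest vertex \<open>t\<close>.\<close>
  have single: "x = x'"
    if i: "i < e" and x: "x \<in> V" "hops v x = i" and x': "x' \<in> V" "hops v x' = i"
      and same: "\<And>w w' p. w \<in> V \<Longrightarrow> w' \<in> V \<Longrightarrow> hops v w = Suc i \<Longrightarrow> hops v w' = Suc i \<Longrightarrow>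
        hops v p = i \<Longrightarrow> (p, w) \<in> E \<Longrightarrow> (p, w') \<in> E"
    for i x x'
  proof (rule ccontr)
    assume "x \<noteq> x'"
    obtain w where w: "w \<in> V" "hops v w = Suc i" using layer_nonempty v t i by (metis Suc_leI)
    then obtain p where p: "(p, w) \<in> E" "hops v p = i" using parentE[of w] by fastforce
    obtain a where a: "a \<in> V" "hops v a = i" "a \<noteq> p" using \<open>x \<noteq> x'\<close> x x' by metis
    have "a \<noteq> v"
      using a p v hops_eq_0_iff arc_verts by metis
    have "twins a t"
    proof (rule twins_if_cdim_large[OF v large])
      fix z assume z: "z \<in> V - {a, t, v}"
      show "\<exists>w. w \<notin> {a, t} \<and> (w, z) \<in> E \<and> hops v w < hops v z"
      proof (cases "hops v z = Suc i")
        case True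
        then have "(p, z) \<in> E" using same w p z by blast
        then show ?thesis using p a True t i by (intro exI[of _ p]) auto
      next
        case False
        then show ?thesis using parentE[of z] z a t by fastforce
      qed
    qed (use a t i \<open>a \<noteq> v\<close> e1 in auto)
    then have "hops v a = hops v t"
      using a t v e1 \<open>a \<noteq> v\<close> by (intro twins_hops_eq) auto
    with a t i show False by simp
  qed
  \<comment> \<open>Downward induction on the layer: the neighbourhoods are uniform because layer \<open>i + 1\<close> is either
    the last one, made of twins, or a single vertex.\<close>
  have below: "x = x'" if "i < e" "x \<in> V" "hops v x = i" "x' \<in> V" "hops v x' = i" for i x x'
    using that
  proof (induction "e - i" arbitrary: i x x' rule: less_induct)
    case less
    have "(p, w') \<in> E" if "w \<in> V" "w' \<in> V" "hops v w = Suc i" "hops v w' = Suc i"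
        "hops v p = i" "(p, w) \<in> E" for w w' p
    proof (cases "Suc i = e")
      case True
      then have "twins w w'" using last_twins that by simp
      then show ?thesis using that arc_sym arc_verts unfolding twins_def
        by (metis Diff_iff insertE n_not_Suc_n singletonD)
    next
      case False
      then have "w = w'" using less.hyps[of "Suc i" w w'] less.prems that by simp
      then show ?thesis using that by simp
    qed
    then show ?case using single[of i x x'] less.prems by blast
  qed
  \<comment> \<open>A last layer with the single vertex \<open>t\<close> could be removed together with the layer before it.\<close>
  have wide: "2 \<le> card {x\<in>V. hops v x = e}" if "e \<noteq> 1"
  proof (rule ccontr)
    assume "\<not> ?thesis"
    then have only: "x = t" if "x \<in> V" "hops v x = e" for x
      using that t pair_finite_verts card_le_Suc0_iff_eq[of "{x\<in>V. hops v x = e}"] by simp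
    obtain a where a: "a \<in> V" "hops v a = e - 1" using layer_nonempty[OF v t(1), of "e - 1"] t by auto
    have "a \<noteq> v" "a \<noteq> t" using a that e1 t by auto
    have "twins a t"
    proof (rule twins_if_cdim_large[OF v large])
      fix z assume z: "z \<in> V - {a, t, v}"
      then obtain w where w: "(w, z) \<in> E" "hops v z = Suc (hops v w)" "hops v w < e"
        using parentE[of z] by auto
      moreover have "hops v z < e" using z only le by fastforce
      ultimately show "\<exists>w. w \<notin> {a, t} \<and> (w, z) \<in> E \<and> hops v w < hops v z"
        using a t by (intro exI[of _ w]) auto
    qed (use a t \<open>a \<noteq> v\<close> \<open>a \<noteq> t\<close> e1 in auto)
    then have "hops v a = hops v t"
      using a t v e1 \<open>a \<noteq> v\<close> by (intro twins_hops_eq) auto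
    then show False using a t e1 by simp
  qed
  have "broom v e"
    unfolding broom_def inj_on_def using e1 le last_twins below t by blast
  then show ?thesis using wide by blast
qed

text \<open>
  A broom is determined by its layers and by one bit \<open>q\<close>, which says whether the last layer is a
  clique. A vertex has a neighbour in the preceding layer, and this layer has only one vertex.
\<close>

lemma broom_adjacency:
  assumes v: "v \<in> V" and b: "broom v e"
  shows "\<exists>q. \<forall>x\<in>V. \<forall>y\<in>V. (x, y) \<in> E \<longleftrightarrow>
     hops v x = Suc (hops v y) \<or> hops v y = Suc (hops v x) \<or> (q \<and> x \<noteq> y \<and> hops v x = hops v y)"
proof -
  define T where "T = {x\<in>V. hops v x = e}"
  have "twins x y" if "x \<in> T" "y \<in> T" for x y
    using b that by (auto simp: broom_def T_def)
  moreover have "T \<subseteq> V" by (auto simp: T_def)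
  ultimately obtain q where q: "\<And>x y. x \<in> T \<Longrightarrow> y \<in> T \<Longrightarrow> x \<noteq> y \<Longrightarrow> (x, y) \<in> E \<longleftrightarrow> q"
    using twins_homogeneous by metis
  have up: "(x, y) \<in> E" if "x \<in> V" "y \<in> V" "hops v y = Suc (hops v x)" for x y
  proof -
    have "y \<noteq> v" using that by auto
    then obtain p where p: "(p, y) \<in> E" "hops v y = Suc (hops v p)"
      using hops_parent[OF v \<open>y \<in> V\<close>] by metis
    moreover have "p = x"
    proof (rule broom_inj[OF b])
      show "hops v p \<noteq> e" using b p(2) \<open>y \<in> V\<close> by (auto simp: broom_def)
    qed (use p that arc_verts in auto)
    ultimately show ?thesis by simp
  qed
  have same: "(x, y) \<in> E \<longleftrightarrow> q \<and> x \<noteq> y" if "x \<in> V" "y \<in> V" "hops v x = hops v y" for x y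
  proof (cases "hops v x = e")
    case True
    then show ?thesis using q[of x y] that arc_irrefl by (auto simp: T_def)
  next
    case False
    then have "x = y" using broom_inj[OF b] that by blast
    then show ?thesis using arc_irrefl by simp
  qed
  have "(x, y) \<in> E \<longleftrightarrow>
     hops v x = Suc (hops v y) \<or> hops v y = Suc (hops v x) \<or> (q \<and> x \<noteq> y \<and> hops v x = hops v y)"
    if "x \<in> V" "y \<in> V" for x y
  proof (cases "hops v x = hops v y")
    case True
    then show ?thesis using same that by simp
  next
    case False
    have "hops v x \<le> Suc (hops v y) \<and> hops v y \<le> Suc (hops v x)" if "(x, y) \<in> E"
      using hops_step[OF v] that arc_sym by blast
    then show ?thesis using False up[of x y] up[of y x] that arc_sym[of y x] by fastforce
  qed
  then show ?thesis by blast
qed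

text \<open>
  A function \<open>h\<close> with these properties is the distance from \<open>v\<close>, so that the layers of a concretely
  given graph can be written down without computing any distances.
\<close>

lemma broomI:
  assumes v: "v \<in> V" and h0: "h v = 0" and e: "1 \<le> e"
    and le: "\<And>x. x \<in> V \<Longrightarrow> h x \<le> e"
    and inj: "inj_on h {x\<in>V. h x < e}"
    and last: "{x\<in>V. h x = e} \<noteq> {}"
    and adj: "\<And>x y. x \<in> V \<Longrightarrow> y \<in> V \<Longrightarrow> (x, y) \<in> E \<longleftrightarrow>
      h x = Suc (h y) \<or> h y = Suc (h x) \<or> (q \<and> x \<noteq> y \<and> h x = h y)"
    and parent: "\<And>x. x \<in> V \<Longrightarrow> x \<noteq> v \<Longrightarrow> \<exists>y\<in>V. h x = Suc (h y)"
  shows "broom v e"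
proof -
  have hops: "hops v x = h x" if "x \<in> V" for x
  proof (rule hops_eqI[of v h x])
    show "h y \<le> Suc (h x)" if "(x, y) \<in> E" for x y
      using adj[of x y] that arc_verts[OF that] by auto
    show "\<exists>y. (y, x) \<in> E \<and> h y < h x" if "x \<in> V" "x \<noteq> v" for x
      using parent[OF that] adj[of _ x] that by fastforce
  qed (use v h0 that in auto)
  have "{x\<in>V. hops v x < e} = {x\<in>V. h x < e}" "{x\<in>V. hops v x = e} = {x\<in>V. h x = e}"
    using hops by auto
  moreover have "inj_on (hops v) {x\<in>V. h x < e}"
    using inj hops by (auto simp: inj_on_def)
  moreover have "twins x y" if "x \<in> V" "y \<in> V" "h x = e" "h y = e" for x y
    unfolding twins_def using adj that by auto
  ultimately show ?thesis using e le last hops unfolding broom_def by simp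
qed

lemma hops_image_below:
  assumes "v \<in> V" "{x\<in>V. hops v x = e} \<noteq> {}"
  shows "hops v ` {x\<in>V. hops v x < e} = {..<e}"
proof (intro equalityI subsetI)
  fix i assume "i \<in> {..<e}"
  moreover obtain t where "t \<in> V" "hops v t = e" using assms by auto
  ultimately obtain x where "x \<in> V" "hops v x = i"
    using layer_nonempty[of v t i] assms(1) by auto
  with \<open>i \<in> {..<e}\<close> show "i \<in> hops v ` {x\<in>V. hops v x < e}" by auto
qed auto

lemma broom_bij_below:
  assumes "v \<in> V" "broom v e"
  shows "bij_betw (hops v) {x\<in>V. hops v x < e} {..<e}"
  using hops_image_below assms by (auto simp: bij_betw_def broom_def)

lemma broom_card:
  assumes v: "v \<in> V" and b: "broom v e"
  shows "card V = e + card {x\<in>V. hops v x = e}"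
proof -
  have "V = {x\<in>V. hops v x < e} \<union> {x\<in>V. hops v x = e}"
    using broom_le[OF b] by (auto simp: le_less)
  then have "card V = card {x\<in>V. hops v x < e} + card {x\<in>V. hops v x = e}"
    using card_Un_disjoint[of "{x\<in>V. hops v x < e}" "{x\<in>V. hops v x = e}"] pair_finite_verts
    by fastforce
  then show ?thesis using bij_betw_same_card[OF broom_bij_below[OF v b]] by simp
qed

lemma cdim_eq_order_minus_1_iff_broom:
  assumes v: "v \<in> V" and n: "2 \<le> card V"
  shows "cdim G v = card V - 1 \<longleftrightarrow> (\<exists>e. broom v e \<and> (e = 1 \<or> e + 2 \<le> card V))"
proof -
  have "2 \<le> card {x\<in>V. hops v x = e} \<longleftrightarrow> e + 2 \<le> card V" if "broom v e" for e
    using broom_card[OF v that] by simp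
  then show ?thesis
    using cdim_broom[OF v] broom_if_cdim_large[OF v n] by (metis order_refl)
qed

text \<open>
  A path is the broom whose last layer has a single vertex.
\<close>

lemma inj_hops_iff_broom:
  assumes v: "v \<in> V" and n: "2 \<le> card V"
  shows "inj_on (hops v) V \<longleftrightarrow> broom v (card V - 1)"
proof
  assume inj: "inj_on (hops v) V"
  obtain e t where e1: "1 \<le> e" and le: "\<And>x. x \<in> V \<Longrightarrow> hops v x \<le> e"
    and t: "t \<in> V" "hops v t = e"
    using eccentricity[OF v n] by metis
  have "x = y" if "x \<in> V" "y \<in> V" "hops v x = hops v y" for x y
    using inj that by (auto dest: inj_onD)
  then have b: "broom v e"
    using e1 le t twins_refl unfolding broom_def inj_on_def by blast
  have "{x\<in>V. hops v x = e} = {t}" using t inj by (auto dest: inj_onD)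
  then have "e = card V - 1" using broom_card[OF v b] by simp
  with b show "broom v (card V - 1)" by simp
next
  let ?e = "card V - 1"
  assume b: "broom v ?e"
  then have "card {x\<in>V. hops v x = ?e} = 1" using broom_card[OF v b] n by simp
  then obtain t where "{x\<in>V. hops v x = ?e} = {t}" by (rule card_1_singletonE)
  then have t: "x = t" if "x \<in> V" "hops v x = ?e" for x using that by blast
  show "inj_on (hops v) V"
  proof (rule inj_onI)
    fix x y assume xy: "x \<in> V" "y \<in> V" "hops v x = hops v y"
    show "x = y"
    proof (cases "hops v x = ?e")
      case True
      then show ?thesis using t[of x] t[of y] xy by simp
    next
      case False
      then show ?thesis using broom_inj[OF b] xy by blast
    qed
  qed
qed

end

section \<open>Isomorphisms as numberings\<close>

text \<open>
  The library represents an isomorphism by maps on vertices and on arcs, applied to the first graph.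
  Without parallel arcs, only the map on vertices carries information, and it is taken from \<open>G\<close> to
  \<open>H\<close> here so that it numbers the vertices of \<open>G\<close> when \<open>H\<close> has vertices \<open>1, \<dots>, n\<close>.
\<close>

lemma iso_mapping_iff:
  assumes H: "pair_wf_digraph H" and G: "pair_wf_digraph G"
    and u: "u \<in> pverts H" and v: "v \<in> pverts G"
  shows "iso_mapping H u G v \<longleftrightarrow>
    (\<exists>g. bij_betw g (pverts G) (pverts H) \<and> g v = u \<and>
      (\<forall>x\<in>pverts G. \<forall>y\<in>pverts G. (x, y) \<in> parcs G \<longleftrightarrow> (g x, g y) \<in> parcs H))"
proof
  assume "iso_mapping H u G v"
  then obtain f where f: "pre_digraph.digraph_isomorphism (with_proj H) f"
      "with_proj G = app_iso f (with_proj H)" "iso_verts f u = v"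
    by (auto simp: iso_mapping_def)
  define k where "k = iso_verts f"
  have inj: "inj_on k (pverts H)"
    using f(1) by (simp add: pre_digraph.digraph_isomorphism_def k_def)
  have img: "k ` pverts H = pverts G" and arcs: "parcs G = iso_arcs f ` parcs H"
    and ends: "iso_tail f = fst" "iso_head f = snd"
    using f(2) by (auto simp: with_proj_def app_iso_def k_def)
  have arc: "iso_arcs f a = (k (fst a), k (snd a))" if "a \<in> parcs H" for a
    using f(1) that ends by (auto simp: pre_digraph.digraph_isomorphism_def k_def prod_eq_iff)
  define g where "g = the_inv_into (pverts H) k"
  have gk: "g (k x) = x" if "x \<in> pverts H" for x
    using inj that by (simp add: g_def the_inv_into_f_f)
  have "(k x, k y) \<in> parcs G \<longleftrightarrow> (x, y) \<in> parcs H" if xy: "x \<in> pverts H" "y \<in> pverts H" for x y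
  proof
    assume "(k x, k y) \<in> parcs G"
    then obtain a where a: "a \<in> parcs H" "(k x, k y) = iso_arcs f a" using arcs by auto
    moreover have "fst a \<in> pverts H" "snd a \<in> pverts H"
      using H a(1) by (metis pair_wf_digraph.arc_fst_in_verts pair_wf_digraph.arc_snd_in_verts)+
    ultimately have "a = (x, y)" using arc[OF a(1)] inj xy by (auto simp: prod_eq_iff dest: inj_onD)
    with a show "(x, y) \<in> parcs H" by simp
  next
    assume "(x, y) \<in> parcs H"
    then show "(k x, k y) \<in> parcs G" using arcs arc by force
  qed
  moreover have "bij_betw g (pverts G) (pverts H)"
    unfolding g_def using inj img by (intro bij_betw_the_inv_into) (simp add: bij_betw_def)
  moreover have "g v = u" using gk u f(3) by (auto simp: k_def)
  ultimately show "\<exists>g. bij_betw g (pverts G) (pverts H) \<and> g v = u \<and>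
      (\<forall>x\<in>pverts G. \<forall>y\<in>pverts G. (x, y) \<in> parcs G \<longleftrightarrow> (g x, g y) \<in> parcs H)"
    using img gk by (intro exI[of _ g]) (metis imageE)
next
  assume "\<exists>g. bij_betw g (pverts G) (pverts H) \<and> g v = u \<and>
      (\<forall>x\<in>pverts G. \<forall>y\<in>pverts G. (x, y) \<in> parcs G \<longleftrightarrow> (g x, g y) \<in> parcs H)"
  then obtain g where g: "bij_betw g (pverts G) (pverts H)" "g v = u"
      "\<And>x y. x \<in> pverts G \<Longrightarrow> y \<in> pverts G \<Longrightarrow> (x, y) \<in> parcs G \<longleftrightarrow> (g x, g y) \<in> parcs H"
    by blast
  define k where "k = the_inv_into (pverts G) g"
  have k: "bij_betw k (pverts H) (pverts G)"
    unfolding k_def using g(1) by (rule bij_betw_the_inv_into)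
  have kg: "k (g x) = x" if "x \<in> pverts G" for x
    using g(1) that by (simp add: k_def bij_betw_def the_inv_into_f_f)
  have gk: "g (k i) = i" if "i \<in> pverts H" for i
    using g(1) that by (simp add: k_def bij_betw_def f_the_inv_into_f)
  have kV: "k i \<in> pverts G" if "i \<in> pverts H" for i
    using k that by (auto simp: bij_betw_def)
  have arcsH: "i \<in> pverts H \<and> j \<in> pverts H" if "(i, j) \<in> parcs H" for i j
    using H that by (force simp: pair_wf_digraph_def)
  have arcsG: "x \<in> pverts G \<and> y \<in> pverts G" if "(x, y) \<in> parcs G" for x y
    using G that by (force simp: pair_wf_digraph_def)
  have arcs: "parcs G = map_prod k k ` parcs H"
  proof (intro equalityI subrelI)
    fix x y assume xy: "(x, y) \<in> parcs G"
    then have "(g x, g y) \<in> parcs H" using g(3) arcsG by blast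
    then show "(x, y) \<in> map_prod k k ` parcs H"
      using kg arcsG[OF xy] by (intro image_eqI[of _ _ "(g x, g y)"]) auto
  next
    fix x y assume "(x, y) \<in> map_prod k k ` parcs H"
    then obtain i j where "(i, j) \<in> parcs H" "x = k i" "y = k j" by auto
    then show "(x, y) \<in> parcs G" using arcsH[of i j] g(3)[of x y] kV gk by simp
  qed
  define f where "f = \<lparr>iso_verts = k, iso_arcs = map_prod k k, iso_head = snd, iso_tail = fst\<rparr>"
  have "inj_on k (pverts H)" using k by (rule bij_betw_imp_inj_on)
  moreover have "inj_on (map_prod k k) (parcs H)"
    using calculation arcsH by (auto simp: inj_on_def)
  ultimately have "pre_digraph.digraph_isomorphism (with_proj H) f"
    using H by (simp add: pre_digraph.digraph_isomorphism_def f_def wf_digraph_wp_iff)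
  moreover have "with_proj G = app_iso f (with_proj H)"
    using arcs k by (simp add: with_proj_def app_iso_def f_def bij_betw_def)
  moreover have "iso_verts f u = v" using kg[OF v] g(2) by (simp add: f_def)
  ultimately show "iso_mapping H u G v" unfolding iso_mapping_def by blast
qed

lemma digraph_iso_iff_iso_mapping:
  assumes "v \<in> pverts G"
  shows "digraph_iso (with_proj H) (with_proj G) \<longleftrightarrow> (\<exists>u\<in>pverts H. iso_mapping H u G v)"
proof -
  have "\<exists>u\<in>pverts H. iso_verts f u = v" if "with_proj G = app_iso f (with_proj H)" for f
  proof -
    have "pverts G = iso_verts f ` pverts H"
      using that by (simp add: with_proj_def app_iso_def)
    with assms show ?thesis by auto
  qed
  then show ?thesis unfolding digraph_iso_def iso_mapping_def by blast
qed

section \<open>The standard brooms\<close>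

text \<open>
  The vertex \<open>i\<close> lies in layer \<open>min (i - 1) e\<close>: the path is \<open>1, \<dots>, e\<close>, and \<open>e + 1, \<dots>, n\<close> are the
  twins. The arcs are those of \<open>broom_adjacency\<close>.
\<close>

definition broom_graph :: "nat \<Rightarrow> nat \<Rightarrow> bool \<Rightarrow> nat pair_pre_digraph" where
  "broom_graph n e q = \<lparr> pverts = {1..n},
     parcs = {(i, j). i \<in> {1..n} \<and> j \<in> {1..n} \<and>
       (min (i - 1) e = Suc (min (j - 1) e) \<or> min (j - 1) e = Suc (min (i - 1) e) \<or>
         (q \<and> i \<noteq> j \<and> min (i - 1) e = min (j - 1) e))} \<rparr>"

text \<open>
  With \<open>e = n - 1\<close> no two vertices share a layer, so the clause that depends on \<open>q\<close> never applies.
\<close>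

lemma path_graph_eq_broom_graph:
  assumes "2 \<le> n"
  shows "path_graph n = broom_graph n (n - 1) q"
proof (rule pair_pre_digraph.equality)
  show "parcs (path_graph n) = parcs (broom_graph n (n - 1) q)"
  proof (intro set_eqI, clarify)
    fix i j :: nat
    show "(i, j) \<in> parcs (path_graph n) \<longleftrightarrow> (i, j) \<in> parcs (broom_graph n (n - 1) q)"
    proof (cases "i \<in> {1..n} \<and> j \<in> {1..n}")
      case True
      then have "min (i - 1) (n - 1) = i - 1" "min (j - 1) (n - 1) = j - 1" by auto
      with True show ?thesis by (auto simp: path_graph_def broom_graph_def)
    qed (auto simp: path_graph_def broom_graph_def)
  qed
qed (auto simp: path_graph_def broom_graph_def)

lemma attach_to_path_eq_broom_graph:
  assumes r: "1 \<le> r" "r \<le> n" and H: "pverts H = {r+1..n}"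
    and arcs: "\<And>i j. (i, j) \<in> parcs H \<longleftrightarrow> q \<and> i \<in> {r+1..n} \<and> j \<in> {r+1..n} \<and> i \<noteq> j"
  shows "attach_to_path r H = broom_graph n r q"
proof (rule pair_pre_digraph.equality)
  show "parcs (attach_to_path r H) = parcs (broom_graph n r q)"
  proof (intro set_eqI, clarify)
    fix i j :: nat
    have left: "(i, j) \<in> parcs (attach_to_path r H) \<longleftrightarrow>
        i \<in> {1..r} \<and> j \<in> {1..r} \<and> (j = i + 1 \<or> i = j + 1) \<or>
        q \<and> i \<in> {r+1..n} \<and> j \<in> {r+1..n} \<and> i \<noteq> j \<or>
        i = r \<and> j \<in> {r+1..n} \<or> i \<in> {r+1..n} \<and> j = r"
      using arcs H by (auto simp: attach_to_path_def path_graph_def)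
    consider "\<not> (i \<in> {1..n} \<and> j \<in> {1..n})" | "i \<in> {1..r}" "j \<in> {1..r}" | "i \<in> {1..r}" "j \<in> {r+1..n}"
      | "i \<in> {r+1..n}" "j \<in> {1..r}" | "i \<in> {r+1..n}" "j \<in> {r+1..n}"
      by (cases "i \<le> r"; cases "j \<le> r"; simp; blast)
    then show "(i, j) \<in> parcs (attach_to_path r H) \<longleftrightarrow> (i, j) \<in> parcs (broom_graph n r q)"
    proof cases
      case 1
      then show ?thesis unfolding left using r by (auto simp: broom_graph_def)
    next
      case 2
      then have "min (i - 1) r = i - 1" "min (j - 1) r = j - 1" by auto
      with 2 r show ?thesis unfolding left by (auto simp: broom_graph_def)
    next
      case 3
      then have "min (i - 1) r = i - 1" "min (j - 1) r = r" by auto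
      with 3 r show ?thesis unfolding left by (auto simp: broom_graph_def)
    next
      case 4
      then have "min (i - 1) r = r" "min (j - 1) r = j - 1" by auto
      with 4 r show ?thesis unfolding left by (auto simp: broom_graph_def)
    next
      case 5
      then have "min (i - 1) r = r" "min (j - 1) r = r" by auto
      with 5 r show ?thesis unfolding left by (auto simp: broom_graph_def)
    qed
  qed
qed (use r H in \<open>auto simp: attach_to_path_def path_graph_def broom_graph_def\<close>)

lemma H_families_eq_broom_graphs:
  "H1_family n \<union> H2_family n = {broom_graph n r q | r q. 2 \<le> r \<and> r + 2 \<le> n}"
proof -
  have "attach_to_path r (empty_graph_on {r+1..n}) = broom_graph n r False"
      "attach_to_path r (complete_graph_on {r+1..n}) = broom_graph n r True"
    if "2 \<le> r \<and> r + 2 \<le> n" for r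
    using that by (auto intro!: attach_to_path_eq_broom_graph simp: empty_graph_on_def complete_graph_on_def)
  then have "H1_family n = {broom_graph n r False | r. 2 \<le> r \<and> r + 2 \<le> n}"
      "H2_family n = {broom_graph n r True | r. 2 \<le> r \<and> r + 2 \<le> n}"
    unfolding H1_family_def H2_family_def by (metis (lifting))+
  then show ?thesis by (auto) (metis (full_types))
qed

lemma pair_wf_digraph_broom_graph: "pair_wf_digraph (broom_graph n e q)"
  by unfold_locales (auto simp: broom_graph_def)

context connected_graph
begin

lemma broom_if_numbering:
  assumes v: "v \<in> V" and e: "1 \<le> e" "e < card V"
    and g: "bij_betw g V {1..card V}" "g v = 1"
    and adj: "\<And>x y. x \<in> V \<Longrightarrow> y \<in> V \<Longrightarrow> (x, y) \<in> E \<longleftrightarrow> (g x, g y) \<in> parcs (broom_graph (card V) e q)"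
  shows "broom v e"
proof (rule broomI[where h = "\<lambda>x. min (g x - 1) e" and q = q])
  have range: "1 \<le> g x \<and> g x \<le> card V" if "x \<in> V" for x
    using g(1) that by (auto simp: bij_betw_def)
  have inj: "x = y" if "x \<in> V" "y \<in> V" "g x = g y" for x y
    using g(1) that by (auto simp: bij_betw_def dest: inj_onD)
  have surj: "\<exists>x\<in>V. g x = i" if "1 \<le> i" "i \<le> card V" for i
    using g(1) that unfolding bij_betw_def by (metis atLeastAtMost_iff imageE)
  show "inj_on (\<lambda>x. min (g x - 1) e) {x\<in>V. min (g x - 1) e < e}"
  proof (rule inj_onI)
    fix x y assume x: "x \<in> {x\<in>V. min (g x - 1) e < e}" and y: "y \<in> {x\<in>V. min (g x - 1) e < e}"
      and "min (g x - 1) e = min (g y - 1) e"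
    then have "g x - 1 = g y - 1" by (simp add: min_def split: if_splits)
    then have "g x = g y" using range[of x] range[of y] x y by simp linarith
    then show "x = y" using inj x y by simp
  qed
  show "{x\<in>V. min (g x - 1) e = e} \<noteq> {}"
    using surj[of "Suc e"] e by fastforce
  show "(x, y) \<in> E \<longleftrightarrow> min (g x - 1) e = Suc (min (g y - 1) e) \<or>
      min (g y - 1) e = Suc (min (g x - 1) e) \<or> (q \<and> x \<noteq> y \<and> min (g x - 1) e = min (g y - 1) e)"
    if "x \<in> V" "y \<in> V" for x y
    using adj[OF that] range[OF that(1)] range[OF that(2)] inj[OF that]
    by (auto simp: broom_graph_def)
  show "\<exists>y\<in>V. min (g x - 1) e = Suc (min (g y - 1) e)" if "x \<in> V" "x \<noteq> v" for x
  proof -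
    have "1 < g x" using range[of x] inj[of x v] that v g(2) by fastforce
    then have "1 \<le> min (g x - 1) e" "min (g x - 1) e \<le> card V" using e by auto
    then obtain y where "y \<in> V" "g y = min (g x - 1) e"
      using surj by blast
    then show ?thesis using \<open>1 < g x\<close> e by (intro bexI[of _ y]) auto
  qed
qed (use v g(2) e in auto)

text \<open>
  Number the path by distance, starting with 1, and the last layer arbitrarily.
\<close>

lemma broom_numbering:
  assumes v: "v \<in> V" and b: "broom v e"
  obtains g q where "bij_betw g V {1..card V}" "g v = 1"
    "\<And>x y. x \<in> V \<Longrightarrow> y \<in> V \<Longrightarrow> (x, y) \<in> E \<longleftrightarrow> (g x, g y) \<in> parcs (broom_graph (card V) e q)"
proof -
  let ?A = "{x\<in>V. hops v x < e}" and ?B = "{x\<in>V. hops v x = e}"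
  have e: "1 \<le> e" using b by (simp add: broom_def)
  have V: "V = ?A \<union> ?B" using broom_le[OF b] by (auto simp: le_less)
  have cardV: "card V = e + card ?B" by (rule broom_card[OF v b])
  have "finite ?B" "card ?B = card {e+1..card V}" using pair_finite_verts cardV by simp_all
  then obtain k where k: "bij_betw k ?B {e+1..card V}"
    using finite_same_card_bij by blast
  define g where "g x = (if hops v x < e then Suc (hops v x) else k x)" for x
  have "bij_betw (\<lambda>x. Suc (hops v x)) ?A {1..e}"
    using bij_betw_trans[OF broom_bij_below[OF v b], of Suc "{1..e}"]
    by (simp add: o_def bij_betw_def image_Suc_lessThan)
  then have "bij_betw g ?A {1..e}" by (rule bij_betw_cong[THEN iffD1, rotated]) (simp add: g_def)
  moreover have "bij_betw g ?B {e+1..card V}"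
    using k by (rule bij_betw_cong[THEN iffD1, rotated]) (simp add: g_def)
  ultimately have "bij_betw g (?A \<union> ?B) ({1..e} \<union> {e+1..card V})"
    by (rule bij_betw_combine) auto
  moreover have "{1..e} \<union> {e+1..card V} = {1..card V}" using cardV by auto
  ultimately have g: "bij_betw g V {1..card V}" using V by simp
  have hops: "hops v x = min (g x - 1) e" if "x \<in> V" for x
  proof (cases "hops v x < e")
    case False
    then have "x \<in> ?B" using that V by auto
    then have "e + 1 \<le> k x" using k by (auto simp: bij_betw_def)
    then show ?thesis using False \<open>x \<in> ?B\<close> by (simp add: g_def)
  qed (simp add: g_def)
  have inj: "g x = g y \<longleftrightarrow> x = y" if "x \<in> V" "y \<in> V" for x y
    using g that by (auto simp: bij_betw_def dest: inj_onD)
  have range: "g x \<in> {1..card V}" if "x \<in> V" for x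
    using g that by (auto simp: bij_betw_def)
  obtain q where q: "\<And>x y. x \<in> V \<Longrightarrow> y \<in> V \<Longrightarrow> (x, y) \<in> E \<longleftrightarrow>
     hops v x = Suc (hops v y) \<or> hops v y = Suc (hops v x) \<or> (q \<and> x \<noteq> y \<and> hops v x = hops v y)"
    using broom_adjacency[OF v b] by blast
  have "(x, y) \<in> E \<longleftrightarrow> (g x, g y) \<in> parcs (broom_graph (card V) e q)" if "x \<in> V" "y \<in> V" for x y
    using q[OF that] inj[OF that] range[OF that(1)] range[OF that(2)] hops[OF that(1)] hops[OF that(2)]
    by (simp add: broom_graph_def)
  moreover have "g v = 1" using e by (simp add: g_def)
  ultimately show ?thesis using that g by blast
qed

lemma broom_iff_iso_mapping:
  assumes v: "v \<in> V" and e: "1 \<le> e" "e < card V"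
  shows "broom v e \<longleftrightarrow> (\<exists>q. iso_mapping (broom_graph (card V) e q) 1 G v)"
proof -
  have "pverts (broom_graph (card V) e q) = {1..card V}" for q by (simp add: broom_graph_def)
  then have "iso_mapping (broom_graph (card V) e q) 1 G v \<longleftrightarrow>
    (\<exists>g. bij_betw g V {1..card V} \<and> g v = 1 \<and>
      (\<forall>x\<in>V. \<forall>y\<in>V. (x, y) \<in> E \<longleftrightarrow> (g x, g y) \<in> parcs (broom_graph (card V) e q)))" for q
    using iso_mapping_iff[OF pair_wf_digraph_broom_graph[of "card V" e q] pair_wf_digraph_axioms _ v, of 1] e
    by simp
  then show ?thesis
    using broom_if_numbering[OF v e] broom_numbering[OF v, of e] by metis
qed

section \<open>End vertices of paths\<close>

lemma degree_eq_card_neighbours: "degree G x = card {y. (x, y) \<in> E}"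
proof -
  have "out_arcs (with_proj G) x = Pair x ` {y. (x, y) \<in> E}"
    by (auto simp: out_arcs_def)
  then show ?thesis by (simp add: out_degree_def card_image inj_on_def)
qed

text \<open>
  The vertex \<open>v\<close> of degree one is at either end of the path; in the second case the numbering is
  reversed.
\<close>

lemma broom_if_end_of_path:
  assumes v: "v \<in> V" and n: "2 \<le> card V"
    and iso: "digraph_iso (with_proj (path_graph (card V))) (with_proj G)" and deg: "degree G v = 1"
  shows "broom v (card V - 1)"
proof -
  let ?n = "card V"
  have P: "path_graph ?n = broom_graph ?n (?n - 1) False"
    using path_graph_eq_broom_graph[OF n] .
  have verts: "pverts (path_graph ?n) = {1..?n}" by (simp add: path_graph_def)
  have "\<exists>u\<in>pverts (path_graph ?n). iso_mapping (path_graph ?n) u G v"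
    using iso by (simp only: digraph_iso_iff_iso_mapping[OF v])
  then obtain u where u: "u \<in> {1..?n}" "iso_mapping (path_graph ?n) u G v"
    using verts by auto
  then obtain g where g: "bij_betw g V {1..?n}" "g v = u"
      "\<And>x y. x \<in> V \<Longrightarrow> y \<in> V \<Longrightarrow> (x, y) \<in> E \<longleftrightarrow> (g x, g y) \<in> parcs (path_graph ?n)"
    using iso_mapping_iff[of "path_graph ?n" G u v] pair_wf_digraph_broom_graph P v verts pair_wf_digraph_axioms
    by auto
  have surj: "\<exists>x\<in>V. g x = i" if "1 \<le> i" "i \<le> ?n" for i
    using g(1) that unfolding bij_betw_def by (metis atLeastAtMost_iff imageE)
  have range: "1 \<le> g x \<and> g x \<le> ?n" if "x \<in> V" for x
    using g(1) that by (auto simp: bij_betw_def)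
  have "u = 1 \<or> u = ?n"
  proof (rule ccontr)
    assume "\<not> ?thesis"
    then have "1 < u" "u < ?n" using u by auto
    then have "1 \<le> u - 1" "u - 1 \<le> ?n" "1 \<le> u + 1" "u + 1 \<le> ?n" by auto
    then obtain a b where ab: "a \<in> V" "g a = u - 1" "b \<in> V" "g b = u + 1"
      using surj by metis
    then have "(v, a) \<in> E" "(v, b) \<in> E"
      using g(2,3) v \<open>1 < u\<close> \<open>u < ?n\<close> by (auto simp: path_graph_def)
    moreover have "a \<noteq> b" using ab by auto
    moreover obtain c where "{y. (v, y) \<in> E} = {c}"
      using deg degree_eq_card_neighbours card_1_singletonE by metis
    ultimately show False by (metis mem_Collect_eq singletonD)
  qed
  then show ?thesis
  proof
    assume "u = 1"
    then have "g v = 1" using g(2) by simp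
    from broom_if_numbering[OF v _ _ g(1) this g(3)[unfolded P]] show ?thesis using n by simp
  next
    assume "u = ?n"
    define k where "k x = ?n + 1 - g x" for x
    have "bij_betw (\<lambda>i. ?n + 1 - i) {1..?n} {1..?n}"
      by (rule bij_betwI[where g = "\<lambda>i. ?n + 1 - i"]) auto
    from bij_betw_trans[OF g(1) this] have k: "bij_betw k V {1..?n}"
      by (simp add: k_def[abs_def] o_def)
    have "k v = 1" using g(2) \<open>u = ?n\<close> by (simp add: k_def)
    have "(x, y) \<in> E \<longleftrightarrow> (k x, k y) \<in> parcs (path_graph ?n)" if "x \<in> V" "y \<in> V" for x y
    proof -
      have "g x \<in> {1..?n}" "g y \<in> {1..?n}" using range that by auto
      moreover from this have "k x \<in> {1..?n}" "k y \<in> {1..?n}"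
          "k y = k x + 1 \<longleftrightarrow> g x = g y + 1" "k x = k y + 1 \<longleftrightarrow> g y = g x + 1"
        unfolding k_def atLeastAtMost_iff by linarith+
      ultimately show ?thesis unfolding g(3)[OF that] path_graph_def by auto
    qed
    from broom_if_numbering[OF v _ _ k \<open>k v = 1\<close> this[unfolded P]] show ?thesis using n by simp
  qed
qed

text \<open>
  Injectivity makes the only vertex of the first layer the only neighbour of \<open>v\<close>, hence the degree.
\<close>

lemma inj_hops_iff_end_of_path:
  assumes v: "v \<in> V" and n: "2 \<le> card V"
  shows "inj_on (hops v) V \<longleftrightarrow>
    digraph_iso (with_proj (path_graph (card V))) (with_proj G) \<and> degree G v = 1"
proof
  assume inj: "inj_on (hops v) V"
  then have b: "broom v (card V - 1)" using inj_hops_iff_broom[OF v n] by simp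
  have le: "1 \<le> card V - 1" and less: "card V - 1 < card V" using n by auto
  obtain q where "iso_mapping (broom_graph (card V) (card V - 1) q) 1 G v"
    using broom_iff_iso_mapping[OF v le less] b by blast
  then have "iso_mapping (path_graph (card V)) 1 G v" by (simp only: path_graph_eq_broom_graph[OF n, of q])
  then have "digraph_iso (with_proj (path_graph (card V))) (with_proj G)"
    using digraph_iso_iff_iso_mapping[OF v, of "path_graph (card V)"] n
    by (auto simp: path_graph_def)
  moreover obtain t where t: "t \<in> V" "hops v t = card V - 1" using b by (auto simp: broom_def)
  obtain w where w: "w \<in> V" "hops v w = 1" using layer_nonempty[OF v t(1), of 1] t(2) le by metis
  have "y = w" if "(v, y) \<in> E" for y
    using inj_onD[OF inj, of y w] hops_eq_1_iff[of v y] arc_verts[OF that] that w by simp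
  then have "{y. (v, y) \<in> E} = {w}" using w v hops_eq_1_iff[of v w] by blast
  then have "degree G v = 1" by (simp add: degree_eq_card_neighbours)
  ultimately show "digraph_iso (with_proj (path_graph (card V))) (with_proj G) \<and> degree G v = 1"
    by simp
next
  assume "digraph_iso (with_proj (path_graph (card V))) (with_proj G) \<and> degree G v = 1"
  then show "inj_on (hops v) V"
    using broom_if_end_of_path[OF v n] inj_hops_iff_broom[OF v n] by simp
qed

section \<open>Complete graphs and stars\<close>

definition star_centre :: "'a \<Rightarrow> bool" where
  "star_centre c \<longleftrightarrow> c \<in> V \<and> E = {c} \<times> (V - {c}) \<union> (V - {c}) \<times> {c}"

lemma complete_bipartite_1_iff:
  assumes "card V = Suc m"
  shows "complete_bipartite_digraph 1 m (with_proj G) \<longleftrightarrow> (\<exists>c. star_centre c)"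
proof
  assume "complete_bipartite_digraph 1 m (with_proj G)"
  then obtain A B where AB: "V = A \<union> B" "A \<inter> B = {}" "card A = 1" "E = A \<times> B \<union> B \<times> A"
    by (auto simp: complete_bipartite_digraph_def)
  then obtain c where "A = {c}" by (metis card_1_singletonE)
  moreover from this AB have "B = V - {c}" by auto
  ultimately show "\<exists>c. star_centre c" using AB by (auto simp: star_centre_def)
next
  assume "\<exists>c. star_centre c"
  then obtain c where c: "c \<in> V" "E = {c} \<times> (V - {c}) \<union> (V - {c}) \<times> {c}"
    by (auto simp: star_centre_def)
  then have "V = {c} \<union> (V - {c})" "{c} \<inter> (V - {c}) = {}" "card {c} = 1" "card (V - {c}) = m"
    using assms pair_finite_verts by auto
  moreover have "graph (with_proj G)" by unfold_locales
  ultimately show "complete_bipartite_digraph 1 m (with_proj G)"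
    unfolding complete_bipartite_digraph_def with_proj_simps using c(2) by blast
qed

lemma complete_digraph_iff:
  "complete_digraph m (with_proj G) \<longleftrightarrow> card V = m \<and> (\<forall>x\<in>V. \<forall>y\<in>V. (x, y) \<in> E \<longleftrightarrow> x \<noteq> y)"
proof -
  have "E = {(x, y). (x, y) \<in> V \<times> V \<and> x \<noteq> y} \<longleftrightarrow> (\<forall>x\<in>V. \<forall>y\<in>V. (x, y) \<in> E \<longleftrightarrow> x \<noteq> y)"
    using arc_verts by (auto simp: set_eq_iff)
  then show ?thesis using pair_finite_verts by (simp add: complete_digraph_pair_def)
qed

text \<open>
  For \<open>e = 1\<close> the twins are all vertices but \<open>v\<close>; they form a clique or an independent set.
\<close>

lemma broom_1_iff:
  assumes v: "v \<in> V" and n: "2 \<le> card V"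
  shows "broom v 1 \<longleftrightarrow> complete_digraph (card V) (with_proj G) \<or> star_centre v"
proof
  assume b: "broom v 1"
  obtain q where q: "\<And>x y. x \<in> V \<Longrightarrow> y \<in> V \<Longrightarrow> (x, y) \<in> E \<longleftrightarrow>
     hops v x = Suc (hops v y) \<or> hops v y = Suc (hops v x) \<or> (q \<and> x \<noteq> y \<and> hops v x = hops v y)"
    using broom_adjacency[OF v b] by blast
  have h: "hops v x = (if x = v then 0 else 1)" if "x \<in> V" for x
    using b hops_eq_0_iff[OF v that] that unfolding broom_def by (force simp: le_Suc_eq)
  show "complete_digraph (card V) (with_proj G) \<or> star_centre v"
  proof (cases q)
    case True
    then have "\<forall>x\<in>V. \<forall>y\<in>V. (x, y) \<in> E \<longleftrightarrow> x \<noteq> y" using q h by auto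
    then show ?thesis by (simp add: complete_digraph_iff)
  next
    case False
    then have "\<forall>x\<in>V. \<forall>y\<in>V. (x, y) \<in> E \<longleftrightarrow> x \<noteq> y \<and> (x = v \<or> y = v)" using q h by auto
    then have "(x, y) \<in> E \<longleftrightarrow> x \<in> V \<and> y \<in> V \<and> x \<noteq> y \<and> (x = v \<or> y = v)" for x y
      using arc_verts by blast
    then have "star_centre v" using v by (auto simp: star_centre_def)
    then show ?thesis ..
  qed
next
  assume G: "complete_digraph (card V) (with_proj G) \<or> star_centre v"
  have "V \<noteq> {v}" using n by auto
  then have other: "\<exists>u\<in>V. u \<noteq> v" using v by blast
  show "broom v 1"
  proof (rule broomI[where h = "\<lambda>x. if x = v then 0 else 1"
        and q = "complete_digraph (card V) (with_proj G)"])
    show "(x, y) \<in> E \<longleftrightarrow> (if x = v then 0 else 1) = Suc (if y = v then 0 else 1) \<or>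
        (if y = v then 0 else 1) = Suc (if x = v then 0 else 1) \<or>
        (complete_digraph (card V) (with_proj G) \<and> x \<noteq> y \<and>
          (if x = v then 0 else 1 :: nat) = (if y = v then 0 else 1))"
      if "x \<in> V" "y \<in> V" for x y
    proof (cases "complete_digraph (card V) (with_proj G)")
      case True
      then show ?thesis using that by (auto simp: complete_digraph_iff)
    next
      case False
      with G have "star_centre v" by simp
      with False show ?thesis using that by (auto simp: star_centre_def)
    qed
  qed (use v other in \<open>auto simp: inj_on_def split: if_splits\<close>)
qed

text \<open>
  Seen from a leaf \<open>v\<close>, a star has the layers \<open>{v}\<close>, \<open>{c}\<close> and the set of all other leaves.
\<close>

lemma broom_2_if_star_leaf:
  assumes v: "v \<in> V" and n: "3 \<le> card V" and c: "star_centre c" "c \<noteq> v"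
  shows "broom v 2"
proof -
  have "V \<noteq> {v, c}" using n c by (auto simp: card_insert_if)
  then obtain u where u: "u \<in> V" "u \<noteq> v" "u \<noteq> c"
    using v c by (auto simp: star_centre_def)
  show ?thesis
    by (rule broomI[where h = "\<lambda>x. if x = v then 0 else if x = c then 1 else 2" and q = False])
      (use v c u in \<open>auto simp: inj_on_def star_centre_def split: if_splits\<close>)
qed

text \<open>
  In \<open>K\<^sub>1\<^sub>,\<^sub>2\<close> the degree tells the centre from the leaves, which have degree one.
\<close>

lemma star_centre_iff_degree_2:
  assumes v: "v \<in> V" and n: "card V = 3"
  shows "star_centre v \<longleftrightarrow> (\<exists>c. star_centre c) \<and> degree G v = 2"
proof -
  have "degree G v = 2" if "star_centre v"
  proof -
    have "{y. (v, y) \<in> E} = V - {v}" using that by (auto simp: star_centre_def)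
    then show ?thesis using v n pair_finite_verts by (simp add: degree_eq_card_neighbours)
  qed
  moreover have "degree G v = 1" if "star_centre c" "c \<noteq> v" for c
  proof -
    have "{y. (v, y) \<in> E} = {c}" using that v by (auto simp: star_centre_def)
    then show ?thesis by (simp add: degree_eq_card_neighbours)
  qed
  moreover have "(1 :: nat) \<noteq> 2" by simp
  ultimately show ?thesis by metis
qed

lemma complete_if_star_order_2:
  assumes "card V = 2" "star_centre c"
  shows "complete_digraph 2 (with_proj G)"
proof -
  have "card (V - {c}) = 1" using assms pair_finite_verts by (simp add: star_centre_def)
  then obtain d where "V - {c} = {d}" by (rule card_1_singletonE)
  then have "V = {c, d}" "c \<noteq> d" using assms by (auto simp: star_centre_def)
  then show ?thesis using assms by (auto simp: complete_digraph_iff star_centre_def)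
qed

end

section \<open>The characterization\<close>

theorem theorem3p9:
  fixes G :: "'a pair_pre_digraph" and n :: nat and v :: 'a
  assumes "pair_graph G"
    and "Digraph_Component.connected (with_proj G)"
    and "card (pverts G) = n" and "n \<ge> 2"
    and "v \<in> pverts G"
  shows "(cdim G v = 1 \<longleftrightarrow>
            digraph_iso (with_proj (path_graph n)) (with_proj G) \<and> degree G v = 1) \<and>
         (cdim G v = n - 1 \<longleftrightarrow>
            (complete_digraph 2 (with_proj G) \<or> complete_digraph 3 (with_proj G) \<or>
              (n \<ge> 4 \<and> (complete_digraph n (with_proj G) \<or>
                          complete_bipartite_digraph 1 (n - 1) (with_proj G)))) \<or>
            (complete_bipartite_digraph 1 2 (with_proj G) \<and> degree G v = 2) \<or>
            (\<exists>H \<in> H1_family n \<union> H2_family n. iso_mapping H 1 G v))"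
    (is "?a \<and> (_ \<longleftrightarrow> ?i \<or> ?ii \<or> ?iii)")
proof (intro conjI)
  interpret connected_graph G
    using assms(1,2) by (simp add: connected_graph_def connected_graph_axioms_def)
  have v: "v \<in> V" and n: "2 \<le> card V" and cardV: "card V = n" using assms by auto
  show ?a
    using cdim_eq_1_iff_inj[OF v] inj_hops_iff_end_of_path[OF v n] cardV by simp
  have iii: "?iii \<longleftrightarrow> (\<exists>e. 2 \<le> e \<and> e + 2 \<le> n \<and> broom v e)"
  proof -
    have "?iii \<longleftrightarrow> (\<exists>e. 2 \<le> e \<and> e + 2 \<le> n \<and> (\<exists>q. iso_mapping (broom_graph n e q) 1 G v))"
      unfolding H_families_eq_broom_graphs by blast
    also have "\<dots> \<longleftrightarrow> (\<exists>e. 2 \<le> e \<and> e + 2 \<le> n \<and> broom v e)"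
      using broom_iff_iso_mapping[OF v] cardV by (intro ex_cong1) auto
    finally show ?thesis .
  qed
  have star: "complete_bipartite_digraph 1 (n - 1) (with_proj G) \<longleftrightarrow> (\<exists>c. star_centre c)"
    using complete_bipartite_1_iff[of "n - 1"] cardV n by simp
  have ii: "?ii \<longleftrightarrow> n = 3 \<and> star_centre v"
  proof -
    have "card V = 3" if bip: "complete_bipartite_digraph 1 2 (with_proj G)"
    proof -
      obtain A B where AB: "V = A \<union> B" "A \<inter> B = {}" "card A = 1" "card B = 2"
        using bip by (auto simp: complete_bipartite_digraph_def)
      then have "finite A" "finite B" using pair_finite_verts by auto
      with AB show ?thesis by (simp add: card_Un_disjoint)
    qed
    then show ?thesis
      using star star_centre_iff_degree_2[OF v] cardV by auto
  qed
  have i: "?i \<longleftrightarrow> complete_digraph n (with_proj G) \<or> (4 \<le> n \<and> (\<exists>c. star_centre c))"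
  proof -
    have "n = 2 \<or> n = 3 \<or> 4 \<le> n" using n cardV by auto
    then show ?thesis using star cardV by (auto simp: complete_digraph_iff)
  qed
  \<comment> \<open>A star with \<open>n \<ge> 4\<close> and \<open>v\<close> at a leaf is already covered by the two families; with \<open>v\<close> at the
    centre, stars with \<open>n = 2\<close> and \<open>n = 3\<close> occur as \<open>K\<^sub>2\<close> and in the \<open>P\<^sub>3\<close> clause.\<close>
  have "?i \<or> ?ii \<or> ?iii \<longleftrightarrow> broom v 1 \<or> (\<exists>e. 2 \<le> e \<and> e + 2 \<le> n \<and> broom v e)"
  proof -
    have "n = 2 \<or> n = 3 \<or> 4 \<le> n" using n cardV by auto
    moreover have "complete_digraph n (with_proj G)" if "n = 2" "star_centre v"
      using complete_if_star_order_2 that cardV by simp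
    moreover have "broom v 2" if "4 \<le> n" "star_centre c" "c \<noteq> v" for c
      using broom_2_if_star_leaf[OF v _ that(2,3)] that cardV by simp
    ultimately show ?thesis
      unfolding i ii iii using broom_1_iff[OF v n] cardV by (metis numeral_Bit0 order_refl)
  qed
  also have "\<dots> \<longleftrightarrow> (\<exists>e. broom v e \<and> (e = 1 \<or> e + 2 \<le> n))"
  proof -
    have "1 \<le> e" if "broom v e" for e using that by (simp add: broom_def)
    then show ?thesis by (metis Suc_1 le_antisym not_less_eq_eq)
  qed
  finally show "cdim G v = n - 1 \<longleftrightarrow> ?i \<or> ?ii \<or> ?iii"
    using cdim_eq_order_minus_1_iff_broom[OF v n] cardV by simp
qed

end
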